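(* Let $n$ be a positive integer and let $a,b$ be non-negative integers. Then $$S_n(\{2\}^a)=2\sum_{k=1}^n\frac{(-1)^{k-1}\binom{n}{k}}{k^{2a}\binom{n+k}{k}},$$ $$S_n(\{2\}^a,3,\{2\}^b)=2\sum_{k=1}^n\frac{(-1)^{k-1}\binom{n}{k}}{k^{2(a+b)+3}\binom{n+k}{k}}+4\sum_{k=1}^n\frac{H_{k-1}(2a+1)\,(-1)^{k-1}\binom{n}{k}}{k^{2b+2}\binom{n+k}{k}}.$$
   Context: For a sequence $(s_1,\dots,s_r)$ of positive integers and an integer $n\ge 0$, $S_n(s_1,\dots,s_r)=\sum_{1\le k_1\le\cdots\le k_r\le n}\frac{1}{k_1^{s_1}\cdots k_r^{s_r}}$, with $S_n(\emptyset)=1$; for a positive integer $s$, $H_n(s)=\sum_{k=1}^n \frac1{k^s}$ (so $H_0(s)=0$). $\{2\}^a$ denotes $2$ repeated $a$ times. *)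

theory Defs
  imports Complex_Main
begin

text \<open>
  The index set of the multiple sum: lists \<open>[k\<^sub>1, \<dots>, k\<^sub>r]\<close> with
  \<open>1 \<le> k\<^sub>1 \<le> \<dots> \<le> k\<^sub>r \<le> n\<close>. For \<open>r = 0\<close> it is \<open>{[]}\<close>, so that the
  empty multiple sum below is 1.
\<close>

definition nondecreasing_indices :: "nat \<Rightarrow> nat \<Rightarrow> nat list set" where
  "nondecreasing_indices n r = {ks. length ks = r \<and> sorted ks \<and> set ks \<subseteq> {1..n}}"

lemma finite_nondecreasing_indices: "finite (nondecreasing_indices n r)"
  unfolding nondecreasing_indices_def
  by (rule finite_subset[OF _ finite_lists_length_eq[of "{1..n}" r]]) auto

definition multiple_harmonic_star_sum :: "nat \<Rightarrow> nat list \<Rightarrow> real" where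
  "multiple_harmonic_star_sum n ss =
     (\<Sum>ks\<in>nondecreasing_indices n (length ss).
        1 / (\<Prod>i<length ss. real (ks ! i) ^ (ss ! i)))"

lemma multiple_harmonic_star_sum_Nil: "multiple_harmonic_star_sum n [] = 1"
proof -
  have "nondecreasing_indices n 0 = {[]}"
    by (auto simp: nondecreasing_indices_def)
  then show ?thesis
    by (simp add: multiple_harmonic_star_sum_def)
qed

definition harmonic_sum :: "nat \<Rightarrow> nat \<Rightarrow> real" where
  "harmonic_sum n s = (\<Sum>k=1..n. 1 / real k ^ s)"

end

theory Submission
  imports Defs
begin

text \<open>
  Write \<open>w n k = (-1)\<^sup>k\<^sup>+\<^sup>1 (n choose k) / (n + k choose k)\<close>. Both formulas expand a star sum as
  \<open>\<Sum>k=1..n. c k * w n k\<close> with coefficients \<open>c k\<close> that do not depend on \<open>n\<close>, and such an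
  expansion is built up one entry at a time. Separating the tuples whose last index is \<open>n\<close>
  from the others gives \<open>S\<^sub>n(ss, s) - S\<^sub>n\<^sub>-\<^sub>1(ss, s) = S\<^sub>n(ss) / n\<^sup>s\<close>, and the weights satisfy
  \<open>w n k - w (n - 1) k = (k / n)\<^sup>2 w n k\<close>. Hence dividing every coefficient by \<open>k\<^sup>2\<close> has the same
  effect on the expansion as appending an entry 2 has on the star sum
  (\<open>multiple_harmonic_star_sum_append_twos\<close>). The first formula follows, starting from the
  expansion \<open>1 = 2 * (\<Sum>k=1..n. w n k)\<close> of the empty star sum.

  Appending the entry 3 divides by one more power of \<open>n\<close>. This factor is absorbed by the closed
  form \<open>(\<Sum>k=j+1..n. w n k) = w n j * (j - n) / (2 * n)\<close> of the tails
  (\<open>sum_star_weight_tail\<close>), which says that \<open>j * w n j / n\<close> is \<open>w n j\<close> plus twice a tail.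
  Exchanging the order of summation turns the tails back into an expansion, whose coefficients
  contain the partial sums of \<open>c j / j\<close> (\<open>sum_coeff_times_index\<close>). For \<open>{2}\<^sup>a\<close>, where
  \<open>c j = 2 / j\<^sup>2\<^sup>a\<close>, these partial sums are twice the harmonic sums in the second formula.
\<close>

text \<open>
  The sign is \<open>(-1)\<^sup>k\<^sup>+\<^sup>1\<close> rather than \<open>(-1)\<^sup>k\<^sup>-\<^sup>1\<close> so that \<open>k = 0\<close> gets the value \<open>-1\<close>; with
  truncated subtraction the relation between neighbouring weights would fail there.
\<close>

definition star_weight :: "nat \<Rightarrow> nat \<Rightarrow> real" where
  "star_weight n k = (- 1) ^ (k + 1) * real (n choose k) / real ((n + k) choose k)"

lemma star_weight_eq:
  assumes "k \<ge> 1"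
  shows "star_weight n k = (- 1) ^ (k - 1) * real (n choose k) / real ((n + k) choose k)"
  using assms by (cases k) (simp_all add: star_weight_def)

lemma star_weight_eq_0: "k > n \<Longrightarrow> star_weight n k = 0"
  by (simp add: star_weight_def binomial_eq_0)

text \<open>
  In this form the two parameters of the weight are separated as far as possible, so that both
  recurrences below reduce to \<open>fact (Suc m) = Suc m * fact m\<close>.
\<close>

lemma star_weight_fact:
  assumes "k \<le> n"
  shows "star_weight n k = (- 1) ^ (k + 1) * (fact n)\<^sup>2 / (fact (n - k) * fact (n + k))"
  using assms by (simp add: star_weight_def binomial_fact power2_eq_square)

lemma star_weight_Suc_index:
  "(real n + real k + 1) * star_weight n (Suc k) = (real k - real n) * star_weight n k"
proof (cases "k < n")
  case True
  then obtain m where n: "n = Suc (m + k)"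
    using less_imp_Suc_add[of k n] by (metis add.commute)
  have "fact (n - k) = (real n - real k) * fact (n - Suc k)"
    "fact (n + Suc k) = (real n + real k + 1) * fact (n + k)"
    using n by (simp_all add: algebra_simps)
  moreover have "real n - real k \<noteq> 0" "real n + real k + 1 \<noteq> 0"
    using True by auto
  ultimately show ?thesis
    using True by (simp add: star_weight_fact divide_simps) (simp add: algebra_simps)
next
  case False
  then show ?thesis
    by (cases "k = n") (simp_all add: star_weight_eq_0)
qed

lemma star_weight_Suc:
  "star_weight (Suc n) k - star_weight n k = (real k / real (Suc n))\<^sup>2 * star_weight (Suc n) k"
proof -
  consider "k \<le> n" | "k = Suc n" | "k > Suc n" by linarith
  then show ?thesis
  proof cases
    case 1
    then have "fact (Suc n - k) = (real (Suc n) - real k) * fact (n - k)"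
      "fact (Suc n + k) = (real (Suc n) + real k) * fact (n + k)"
      by (simp_all add: Suc_diff_le of_nat_diff algebra_simps)
    moreover have "fact (Suc n) = real (Suc n) * fact n"
      by simp
    moreover have "real (Suc n) - real k \<noteq> 0" "real (Suc n) + real k \<noteq> 0" "real (Suc n) \<noteq> 0"
      using 1 by auto
    ultimately show ?thesis
      using 1
      by (simp add: star_weight_fact divide_simps power2_eq_square del: fact_Suc of_nat_Suc)
        (simp add: algebra_simps)
  qed (simp_all add: star_weight_eq_0 del: of_nat_Suc)
qed

text \<open>
  The right-hand side vanishes at \<open>j = n\<close> and, by \<open>star_weight_Suc_index\<close>, increases by
  \<open>star_weight n j\<close> on passing from \<open>j\<close> to \<open>j - 1\<close>.
\<close>

lemma sum_star_weight_tail: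
  assumes "n \<ge> 1" "j \<le> n"
  shows "(\<Sum>k=Suc j..n. star_weight n k) = star_weight n j * (real j - real n) / (2 * real n)"
  using assms(2)
proof (induction rule: inc_induct)
  case base
  show ?case by simp
next
  case (step j)
  have "(\<Sum>k=Suc j..n. star_weight n k)
      = star_weight n (Suc j) + (\<Sum>k=Suc (Suc j)..n. star_weight n k)"
    using step.hyps by (simp add: sum.atLeast_Suc_atMost)
  also have "\<dots> = star_weight n (Suc j) * (real n + real j + 1) / (2 * real n)"
    using assms(1) by (simp add: step.IH field_simps)
  also have "\<dots> = star_weight n j * (real j - real n) / (2 * real n)"
    using star_weight_Suc_index[of n j] by (simp add: mult.commute)
  finally show ?case .
qed

lemma sum_star_weight:
  assumes "n \<ge> 1"
  shows "2 * (\<Sum>k=1..n. star_weight n k) = 1"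
  using sum_star_weight_tail[of n 0] assms by (simp add: star_weight_def)

text \<open>
  This trades a factor \<open>k / n\<close>, which depends on \<open>n\<close>, for a change of the coefficients that
  does not.
\<close>

lemma sum_coeff_times_index:
  assumes "n \<ge> 1"
  shows "(\<Sum>k=1..n. real k * d k * star_weight n k) / real n
      = (\<Sum>k=1..n. (d k + 2 * (\<Sum>j=1..k-1. d j)) * star_weight n k)"
proof -
  have swap: "(\<Sum>k=1..n. (\<Sum>j=1..k-1. d j) * star_weight n k)
      = (\<Sum>j=1..n. d j * (\<Sum>k=Suc j..n. star_weight n k))"
    unfolding sum_distrib_left sum_distrib_right
    by (subst sum.Sigma, simp, simp, subst sum.Sigma, simp, simp,
        rule sum.reindex_bij_witness[of _ prod.swap prod.swap]) auto
  have "(\<Sum>k=1..n. real k * d k * star_weight n k) / real n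
      = (\<Sum>j=1..n. d j * star_weight n j + 2 * (d j * (\<Sum>k=Suc j..n. star_weight n k)))"
    unfolding sum_divide_distrib
    by (intro sum.cong) (use assms in \<open>auto simp: sum_star_weight_tail field_simps\<close>)
  also have "\<dots> = (\<Sum>k=1..n. d k * star_weight n k)
      + 2 * (\<Sum>k=1..n. (\<Sum>j=1..k-1. d j) * star_weight n k)"
    by (simp only: sum.distrib swap sum_distrib_left)
  also have "\<dots> = (\<Sum>k=1..n. (d k + 2 * (\<Sum>j=1..k-1. d j)) * star_weight n k)"
    by (simp only: sum.distrib distrib_right sum_distrib_left[of 2 _ "{1..n}"] mult.assoc)
  finally show ?thesis .
qed

text \<open>
  The counterpart, for expansions in the weights, of the recurrence that appending an entry 2
  imposes on star sums.
\<close>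

lemma sum_star_weight_Suc:
  "(\<Sum>k=1..Suc n. c k / real k ^ 2 * star_weight (Suc n) k)
    = (\<Sum>k=1..n. c k / real k ^ 2 * star_weight n k)
      + (\<Sum>k=1..Suc n. c k * star_weight (Suc n) k) / real (Suc n) ^ 2"
proof -
  have "(\<Sum>k=1..n. c k / real k ^ 2 * star_weight n k)
      = (\<Sum>k=1..Suc n. c k / real k ^ 2 * star_weight n k)"
    by (simp add: star_weight_eq_0)
  then have "(\<Sum>k=1..Suc n. c k / real k ^ 2 * star_weight (Suc n) k)
      - (\<Sum>k=1..n. c k / real k ^ 2 * star_weight n k)
      = (\<Sum>k=1..Suc n. c k / real k ^ 2 * (star_weight (Suc n) k - star_weight n k))"
    by (simp only: sum_subtractf right_diff_distrib)
  also have "\<dots> = (\<Sum>k=1..Suc n. c k * star_weight (Suc n) k) / real (Suc n) ^ 2"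
    unfolding sum_divide_distrib star_weight_Suc
    by (intro sum.cong) (auto simp: power_divide simp del: of_nat_Suc)
  finally show ?thesis by linarith
qed

lemma nondecreasing_indices_Suc:
  "nondecreasing_indices (Suc n) (Suc r) =
     nondecreasing_indices n (Suc r) \<union> (\<lambda>ks. ks @ [Suc n]) ` nondecreasing_indices (Suc n) r"
  (is "?L = ?A \<union> ?B")
proof (intro subset_antisym subsetI)
  fix ks assume ks: "ks \<in> ?L"
  then obtain xs x where [simp]: "ks = xs @ [x]"
    by (cases ks rule: rev_cases) (auto simp: nondecreasing_indices_def)
  show "ks \<in> ?A \<union> ?B"
  proof (cases "x = Suc n")
    case True
    then show ?thesis using ks by (auto simp: nondecreasing_indices_def sorted_append)
  next
    case False
    then have "x \<le> n" using ks by (auto simp: nondecreasing_indices_def)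
    then have "ks \<in> ?A"
      using ks by (fastforce simp: nondecreasing_indices_def sorted_append)
    then show ?thesis ..
  qed
next
  fix ks assume "ks \<in> ?A \<union> ?B"
  then show "ks \<in> ?L"
    by (fastforce simp: nondecreasing_indices_def sorted_append)
qed

lemma multiple_harmonic_star_sum_0_snoc: "multiple_harmonic_star_sum 0 (ss @ [s]) = 0"
proof -
  have "nondecreasing_indices 0 (length (ss @ [s])) = {}"
    by (auto simp: nondecreasing_indices_def)
  then show ?thesis by (simp add: multiple_harmonic_star_sum_def)
qed

lemma multiple_harmonic_star_sum_Suc_snoc:
  "multiple_harmonic_star_sum (Suc n) (ss @ [s]) =
     multiple_harmonic_star_sum n (ss @ [s])
     + multiple_harmonic_star_sum (Suc n) ss / real (Suc n) ^ s"
proof -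
  let ?t = "\<lambda>ss ks. 1 / (\<Prod>i<length ss. real (ks ! i) ^ (ss ! i))"
  let ?A = "nondecreasing_indices n (Suc (length ss))"
  let ?C = "nondecreasing_indices (Suc n) (length ss)"
  let ?B = "(\<lambda>ks. ks @ [Suc n]) ` ?C"
  have summand: "?t (ss @ [s]) (ks @ [Suc n]) = ?t ss ks / real (Suc n) ^ s" if "ks \<in> ?C" for ks
  proof -
    have "length ks = length ss" using that by (simp add: nondecreasing_indices_def)
    then have "(\<Prod>i<length (ss @ [s]). real ((ks @ [Suc n]) ! i) ^ ((ss @ [s]) ! i))
        = (\<Prod>i<length ss. real (ks ! i) ^ (ss ! i)) * real (Suc n) ^ s"
      by (simp add: nth_append del: of_nat_Suc)
    then show ?thesis by (simp del: of_nat_Suc)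
  qed
  have "?A \<inter> ?B = {}"
    by (auto simp: nondecreasing_indices_def)
  then have "multiple_harmonic_star_sum (Suc n) (ss @ [s])
      = (\<Sum>ks\<in>?A. ?t (ss @ [s]) ks) + (\<Sum>ks\<in>?B. ?t (ss @ [s]) ks)"
    unfolding multiple_harmonic_star_sum_def length_append_singleton nondecreasing_indices_Suc
    by (intro sum.union_disjoint) (simp_all add: finite_nondecreasing_indices)
  also have "(\<Sum>ks\<in>?B. ?t (ss @ [s]) ks) = (\<Sum>ks\<in>?C. ?t (ss @ [s]) (ks @ [Suc n]))"
    by (subst sum.reindex) (auto intro: inj_onI)
  also have "\<dots> = multiple_harmonic_star_sum (Suc n) ss / real (Suc n) ^ s"
    unfolding multiple_harmonic_star_sum_def sum_divide_distrib
    by (intro sum.cong refl summand)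
  finally show ?thesis
    by (simp add: multiple_harmonic_star_sum_def)
qed

lemma multiple_harmonic_star_sum_snoc_eqI:
  fixes f :: "nat \<Rightarrow> real"
  assumes "f 0 = 0"
    and "\<And>n. f (Suc n) = f n + multiple_harmonic_star_sum (Suc n) ss / real (Suc n) ^ s"
  shows "multiple_harmonic_star_sum n (ss @ [s]) = f n"
  by (induction n)
    (simp_all add: multiple_harmonic_star_sum_0_snoc multiple_harmonic_star_sum_Suc_snoc assms)

text \<open>
  The restriction to \<open>n \<ge> 1\<close> makes \<open>ss = []\<close> an instance: the empty star sum is 1 at \<open>n = 0\<close>,
  while every expansion vanishes there.
\<close>

lemma multiple_harmonic_star_sum_append_twos:
  assumes "\<And>n. n \<ge> 1 \<Longrightarrow> multiple_harmonic_star_sum n ss = (\<Sum>k=1..n. c k * star_weight n k)"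
    and "n \<ge> 1"
  shows "multiple_harmonic_star_sum n (ss @ replicate b 2)
      = (\<Sum>k=1..n. c k / real k ^ (2 * b) * star_weight n k)"
  using assms(2)
proof (induction b arbitrary: n)
  case 0
  then show ?case by (simp add: assms(1))
next
  case (Suc b)
  let ?d = "\<lambda>k. c k / real k ^ (2 * b)"
  have "multiple_harmonic_star_sum n ((ss @ replicate b 2) @ [2])
      = (\<Sum>k=1..n. ?d k / real k ^ 2 * star_weight n k)"
  proof (rule multiple_harmonic_star_sum_snoc_eqI)
    fix m
    have one_le_Suc: "Suc m \<ge> 1" by simp
    show "(\<Sum>k=1..Suc m. ?d k / real k ^ 2 * star_weight (Suc m) k)
        = (\<Sum>k=1..m. ?d k / real k ^ 2 * star_weight m k)
          + multiple_harmonic_star_sum (Suc m) (ss @ replicate b 2) / real (Suc m) ^ 2"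
      by (simp only: sum_star_weight_Suc Suc.IH[of "Suc m", OF one_le_Suc])
  qed simp
  then show ?case
    by (simp add: replicate_append_same power2_eq_square mult_ac)
qed

text \<open>
  Two of the three powers of \<open>n\<close> are produced by \<open>sum_star_weight_Suc\<close>, the third one by
  \<open>sum_coeff_times_index\<close>.
\<close>

lemma multiple_harmonic_star_sum_snoc_three:
  assumes "\<And>n. n \<ge> 1 \<Longrightarrow> multiple_harmonic_star_sum n ss = (\<Sum>k=1..n. c k * star_weight n k)"
  shows "multiple_harmonic_star_sum n (ss @ [3])
      = (\<Sum>k=1..n. (c k / real k + 2 * (\<Sum>j=1..k-1. c j / real j)) / real k ^ 2 * star_weight n k)"
    (is "_ = (\<Sum>k=1..n. ?e k / real k ^ 2 * star_weight n k)")
proof (rule multiple_harmonic_star_sum_snoc_eqI)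
  fix m
  have one_le_Suc: "Suc m \<ge> 1" by simp
  have "multiple_harmonic_star_sum (Suc m) ss
      = (\<Sum>k=1..Suc m. real k * (c k / real k) * star_weight (Suc m) k)"
    unfolding assms[of "Suc m", OF one_le_Suc] by (intro sum.cong) auto
  then have "multiple_harmonic_star_sum (Suc m) ss / real (Suc m)
      = (\<Sum>k=1..Suc m. ?e k * star_weight (Suc m) k)"
    using sum_coeff_times_index[of "Suc m" "\<lambda>k. c k / real k"] by simp
  moreover have "multiple_harmonic_star_sum (Suc m) ss / real (Suc m) ^ 3
      = multiple_harmonic_star_sum (Suc m) ss / real (Suc m) / real (Suc m) ^ 2"
    by (simp add: power3_eq_cube power2_eq_square mult.assoc)
  ultimately show "(\<Sum>k=1..Suc m. ?e k / real k ^ 2 * star_weight (Suc m) k)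
      = (\<Sum>k=1..m. ?e k / real k ^ 2 * star_weight m k)
        + multiple_harmonic_star_sum (Suc m) ss / real (Suc m) ^ 3"
    by (simp only: sum_star_weight_Suc)
qed simp

theorem corollary2p1:
  fixes n a b :: nat
  assumes "n \<ge> 1"
  shows "multiple_harmonic_star_sum n (replicate a 2) =
           2 * (\<Sum>k=1..n. ((- 1) ^ (k - 1) * real (n choose k)) /
                 (real k ^ (2 * a) * real ((n + k) choose k)))
       \<and> multiple_harmonic_star_sum n (replicate a 2 @ [3] @ replicate b 2) =
           2 * (\<Sum>k=1..n. ((- 1) ^ (k - 1) * real (n choose k)) /
                 (real k ^ (2 * (a + b) + 3) * real ((n + k) choose k)))
         + 4 * (\<Sum>k=1..n. (harmonic_sum (k - 1) (2 * a + 1) * (- 1) ^ (k - 1) * real (n choose k)) /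
                 (real k ^ (2 * b + 2) * real ((n + k) choose k)))"
proof
  have twos: "multiple_harmonic_star_sum m (replicate a 2)
      = (\<Sum>k=1..m. 2 / real k ^ (2 * a) * star_weight m k)" if "m \<ge> 1" for m
  proof -
    have "multiple_harmonic_star_sum m [] = (\<Sum>k=1..m. 2 * star_weight m k)" if "m \<ge> 1" for m
      using sum_star_weight[OF that]
      by (simp only: multiple_harmonic_star_sum_Nil sum_distrib_left)
    from multiple_harmonic_star_sum_append_twos[OF this \<open>m \<ge> 1\<close>]
    show ?thesis by simp
  qed
  show "multiple_harmonic_star_sum n (replicate a 2) =
      2 * (\<Sum>k=1..n. ((- 1) ^ (k - 1) * real (n choose k)) /
            (real k ^ (2 * a) * real ((n + k) choose k)))"
    unfolding twos[OF assms] sum_distrib_left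
    by (intro sum.cong) (auto simp: star_weight_eq)
  let ?e = "\<lambda>k. (2 / real k ^ (2 * a) / real k
      + 2 * (\<Sum>j=1..k-1. 2 / real j ^ (2 * a) / real j)) / real k ^ 2"
  have e: "?e k = 2 / real k ^ (2 * a + 3) + 4 * harmonic_sum (k - 1) (2 * a + 1) / real k ^ 2"
    if "k \<ge> 1" for k
    using that
    by (simp add: harmonic_sum_def sum_distrib_left power_add power2_eq_square
        power3_eq_cube field_simps)
  have "multiple_harmonic_star_sum n ((replicate a 2 @ [3]) @ replicate b 2)
      = (\<Sum>k=1..n. ?e k / real k ^ (2 * b) * star_weight n k)"
    by (intro multiple_harmonic_star_sum_append_twos multiple_harmonic_star_sum_snoc_three
        twos assms)
  also have "\<dots> = (\<Sum>k=1..n.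
        2 * (((- 1) ^ (k - 1) * real (n choose k)) /
            (real k ^ (2 * (a + b) + 3) * real ((n + k) choose k)))
      + 4 * ((harmonic_sum (k - 1) (2 * a + 1) * (- 1) ^ (k - 1) * real (n choose k)) /
            (real k ^ (2 * b + 2) * real ((n + k) choose k))))"
  proof (intro sum.cong refl)
    fix k assume "k \<in> {1..n}"
    then have k: "k \<ge> 1" by simp
    show "?e k / real k ^ (2 * b) * star_weight n k =
        2 * (((- 1) ^ (k - 1) * real (n choose k)) /
            (real k ^ (2 * (a + b) + 3) * real ((n + k) choose k)))
      + 4 * ((harmonic_sum (k - 1) (2 * a + 1) * (- 1) ^ (k - 1) * real (n choose k)) /
            (real k ^ (2 * b + 2) * real ((n + k) choose k)))"
      unfolding e[OF k] star_weight_eq[OF k]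
      using k by (simp add: add_divide_distrib ring_distribs power_add power2_eq_square mult_ac)
  qed
  finally show "multiple_harmonic_star_sum n (replicate a 2 @ [3] @ replicate b 2) =
      2 * (\<Sum>k=1..n. ((- 1) ^ (k - 1) * real (n choose k)) /
            (real k ^ (2 * (a + b) + 3) * real ((n + k) choose k)))
    + 4 * (\<Sum>k=1..n. (harmonic_sum (k - 1) (2 * a + 1) * (- 1) ^ (k - 1) * real (n choose k)) /
            (real k ^ (2 * b + 2) * real ((n + k) choose k)))"
    by (simp add: sum.distrib sum_distrib_left)
qed

end
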